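(* Let $n\ge1$ and let $\theta$ be an integer. Let $k,l,p$ be nonnegative integers with $$n=\frac{k(k+1)}{2}|1-\theta|+l(k+1)+p,\qquad 0\le l<|1-\theta|,\quad 0\le p\le k+1.$$ Then the length of a maximal chain in $L(n,\theta)$ is equal to $E(P(\theta))$, where $P(\theta)$ is the fixed point of $L(n,\theta)$; that is, it is equal to $$(\theta-1)\frac{(k-1)k(k+1)}{6}+l\,\frac{k(k+1)}{2}+p\,\frac{2k-p+1}{2}\qquad\text{if }\theta\ge2,$$ and to $$(1-\theta)\frac{(3n-k-2)k(k+1)}{6}+l\,\frac{(k+1)(2n-k-2)}{2}+p\,\frac{2n-p-1}{2}\qquad\text{if }\theta\le1.$$
   Context: A composition of $n$ is a sequence $a=(a_1,\ldots,a_n)$ of nonnegative integers with $\sum a_i=n$ (not necessarily decreasing, zeros allowed). For an integer $\theta$, a transition $T(\theta)$ transforms a composition $a$ into the composition $(a_1,\ldots,a_i-1,a_{i+1}+1,\ldots,a_n)$ for some $1\le i\le n-1$ with $a_i-a_{i+1}\ge\theta$ (and $a_i\ge1$, so that the result is a composition). $L(n,\theta)$ is the set of all compositions obtained from $N=(n,0,\ldots,0)$ by iterating $T(\theta)$, ordered by: $a\ge_\theta b$ iff $b$ is obtained from $a$ by a (possibly empty) finite sequence of transitions $T(\theta)$. The fixed point $P(\theta)$ of $L(n,\theta)$ is the unique element of $L(n,\theta)$ on which no transition $T(\theta)$ can be applied; it is the smallest element of $L(n,\theta)$. The energy of a composition $a$ is $E(a)=\sum_{i=1}^n(i-1)a_i$.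 The length of a chain is its number of elements minus one. *)

theory Defs
  imports Complex_Main
begin

text \<open>
  A composition \<open>(a\<^sub>1, \<dots>, a\<^sub>n)\<close> is a list of length \<open>n\<close>; indices are shifted by one,
  so \<open>a\<^sub>i\<close> is \<open>a ! (i - 1)\<close>.
\<close>

definition compositions :: "nat \<Rightarrow> nat list set" where
  "compositions n = {a. length a = n \<and> sum_list a = n}"

text \<open>
  The difference is taken in the integers, since \<open>\<theta>\<close> may be negative. The condition
  \<open>1 \<le> a ! i\<close> makes the natural-number subtraction exact.
\<close>

definition transition :: "int \<Rightarrow> nat list \<Rightarrow> nat list \<Rightarrow> bool" where
  "transition \<theta> a b \<longleftrightarrow>
     (\<exists>i. Suc i < length a \<and> int (a ! i) - int (a ! Suc i) \<ge> \<theta> \<and> 1 \<le> a ! i \<and>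
          b = a[i := a ! i - 1, Suc i := a ! Suc i + 1])"

definition top_composition :: "nat \<Rightarrow> nat list" where
  "top_composition n = n # replicate (n - 1) 0"

definition geq :: "int \<Rightarrow> nat list \<Rightarrow> nat list \<Rightarrow> bool" where
  "geq \<theta> = (transition \<theta>)\<^sup>*\<^sup>*"

definition L :: "nat \<Rightarrow> int \<Rightarrow> nat list set" where
  "L n \<theta> = {a \<in> compositions n. geq \<theta> (top_composition n) a}"

definition is_fixed_point :: "nat \<Rightarrow> int \<Rightarrow> nat list \<Rightarrow> bool" where
  "is_fixed_point n \<theta> a \<longleftrightarrow> a \<in> L n \<theta> \<and> (\<nexists>b. transition \<theta> a b)"

definition fixed_point :: "nat \<Rightarrow> int \<Rightarrow> nat list" where
  "fixed_point n \<theta> = (THE a. is_fixed_point n \<theta> a)"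

text \<open>With indices starting at zero the weight \<open>i - 1\<close> becomes \<open>i\<close>.\<close>

definition energy :: "nat list \<Rightarrow> nat" where
  "energy a = (\<Sum>i<length a. i * a ! i)"

text \<open>Maximality is with respect to inclusion among all chains of the poset.\<close>

definition maximal_chain :: "nat \<Rightarrow> int \<Rightarrow> nat list set \<Rightarrow> bool" where
  "maximal_chain n \<theta> C \<longleftrightarrow> pred_on.maxchain (L n \<theta>) (geq \<theta>) C"

text \<open>Integer-valued, so that no truncated subtraction occurs.\<close>

definition chain_length :: "nat list set \<Rightarrow> int" where
  "chain_length C = int (card C) - 1"

end

theory Submission
  imports Defs
begin

text \<open>
  Every transition raises the energy by one, so \<open>L n \<theta>\<close> is graded by the energy, and its maximal
  chains run from the top composition (energy 0) to the fixed point without gaps.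

  Put \<open>d = 1 - \<theta>\<close>. All elements of \<open>L n \<theta>\<close> satisfy \<open>a\<^sub>j - a\<^sub>i \<le> (j - i) d + 1\<close> for \<open>i < j\<close> with
  \<open>a\<^sub>j > 0\<close>, while no transition applies iff \<open>a\<^sub>i\<^sub>+\<^sub>1 - a\<^sub>i \<ge> d\<close> whenever \<open>a\<^sub>i > 0\<close>. Two compositions
  satisfying both conditions cannot cross, that is, they are comparable pointwise; having the same
  sum, they are equal. Thus the fixed point is any composition satisfying both conditions, for
  instance an arithmetic progression with difference \<open>d\<close> occupying the first (\<open>\<theta> \<ge> 2\<close>) or last
  (\<open>\<theta> \<le> 0\<close>) \<open>k + 1\<close> positions, whose \<open>p\<close> rightmost entries are raised by one.
\<close>

section \<open>Two slope conditions and their behaviour under transitions\<close>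

text \<open>Zero entries \<open>a ! j\<close> are exempt because the zero tail of the top
  composition would violate the bound for large \<theta>. The slack 1 is attained right after a
  transition. All pairs are compared, not only neighbours, since from neighbours alone the slack
  would add up.\<close>

definition slope_bounded :: "int \<Rightarrow> nat list \<Rightarrow> bool" where
  "slope_bounded \<theta> a \<longleftrightarrow> (\<forall>i j. i < j \<longrightarrow> j < length a \<longrightarrow> 0 < a ! j \<longrightarrow>
     int (a ! j) - int (a ! i) \<le> (int j - int i) * (1 - \<theta>) + 1)"

definition slope_stable :: "int \<Rightarrow> nat list \<Rightarrow> bool" where
  "slope_stable \<theta> a \<longleftrightarrow> (\<forall>i. Suc i < length a \<longrightarrow> 0 < a ! i \<longrightarrow>
     1 - \<theta> \<le> int (a ! Suc i) - int (a ! i))"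

lemma slope_stable_iff: "slope_stable \<theta> a \<longleftrightarrow> (\<nexists>b. transition \<theta> a b)"
  unfolding slope_stable_def transition_def by (fastforce simp: Suc_le_eq)

text \<open>The list update in indicator form over \<open>int\<close>, so that sums and case
  distinctions on \<open>j\<close> meet no truncated subtraction.\<close>

lemma transitionE:
  assumes "transition \<theta> a b"
  obtains m where "Suc m < length a" "\<theta> \<le> int (a ! m) - int (a ! Suc m)" "0 < a ! m"
    "length b = length a"
    "\<And>j. j < length a \<Longrightarrow>
       int (b ! j) = int (a ! j) - (if j = m then 1 else 0) + (if j = Suc m then 1 else 0)"
proof -
  from assms obtain m where m: "Suc m < length a" "int (a ! m) - int (a ! Suc m) \<ge> \<theta>" "1 \<le> a ! m"
    and b: "b = a[m := a ! m - 1, Suc m := a ! Suc m + 1]"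
    unfolding transition_def by blast
  show ?thesis
    by (rule that[of m]) (use m b in \<open>auto simp: nth_list_update of_nat_diff\<close>)
qed

text \<open>One unit moves from \<open>m\<close> to \<open>Suc m\<close>. Weight \<open>j\<close>
  turns this into the growth of the energy, weight 1 into the invariance of the sum.\<close>

lemma transition_weighted_sum:
  fixes w :: "nat \<Rightarrow> int"
  assumes "transition \<theta> a b"
  obtains m where "length b = length a"
    "(\<Sum>j<length b. w j * int (b ! j)) = (\<Sum>j<length a. w j * int (a ! j)) - w m + w (Suc m)"
proof -
  from assms obtain m where m: "Suc m < length a" "length b = length a"
    and b: "\<And>j. j < length a \<Longrightarrow>
       int (b ! j) = int (a ! j) - (if j = m then 1 else 0) + (if j = Suc m then 1 else 0)"
    by (rule transitionE) blast
  have "(\<Sum>j<length b. w j * int (b ! j)) =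
      (\<Sum>j<length a. w j * int (a ! j) - (if j = m then w j else 0) + (if j = Suc m then w j else 0))"
    by (intro sum.cong) (auto simp: m b right_diff_distrib distrib_left)
  also have "\<dots> = (\<Sum>j<length a. w j * int (a ! j)) - w m + w (Suc m)"
    using m by (simp add: sum.distrib sum_subtractf)
  finally show ?thesis using m(2) that by blast
qed

lemma transition_energy: "transition \<theta> a b \<Longrightarrow> energy b = Suc (energy a)"
proof -
  assume "transition \<theta> a b"
  then obtain m where "(\<Sum>j<length b. int j * int (b ! j)) =
      (\<Sum>j<length a. int j * int (a ! j)) - int m + int (Suc m)"
    by (rule transition_weighted_sum)
  then have "int (energy b) = int (energy a) + 1" by (simp add: energy_def)
  then show ?thesis by simp
qed

lemma transition_compositions:
  assumes "transition \<theta> a b" and "a \<in> compositions n"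
  shows "b \<in> compositions n"
proof -
  from assms(1) obtain m where "length b = length a"
    "(\<Sum>j<length b. 1 * int (b ! j)) = (\<Sum>j<length a. 1 * int (a ! j)) - 1 + 1"
    using transition_weighted_sum[where w = "\<lambda>_. 1"] by blast
  then have "int (sum_list b) = int (sum_list a)"
    by (simp add: sum_list_sum_nth atLeast0LessThan)
  with \<open>length b = length a\<close> assms(2) show ?thesis by (simp add: compositions_def)
qed

lemma transition_slope_bounded:
  assumes "transition \<theta> a b" and "slope_bounded \<theta> a"
  shows "slope_bounded \<theta> b"
  unfolding slope_bounded_def
proof (intro allI impI)
  fix i j assume ij: "i < j" "j < length b" "0 < b ! j"
  from assms(1) obtain m where m: "Suc m < length a" "\<theta> \<le> int (a ! m) - int (a ! Suc m)"
      "0 < a ! m" "length b = length a"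
    and b: "\<And>j. j < length a \<Longrightarrow>
       int (b ! j) = int (a ! j) - (if j = m then 1 else 0) + (if j = Suc m then 1 else 0)"
    by (rule transitionE) blast
  have a: "int (a ! j) - int (a ! i) \<le> (int j - int i) * (1 - \<theta>) + 1"
    if "i < j" "j < length a" "0 < a ! j" for i j
    using assms(2) that unfolding slope_bounded_def by blast
  have bi: "int (b ! i) = int (a ! i) - (if i = m then 1 else 0) + (if i = Suc m then 1 else 0)"
    and bj: "int (b ! j) = int (a ! j) - (if j = m then 1 else 0) + (if j = Suc m then 1 else 0)"
    using b ij m by auto
  consider "i = m" "j = Suc m" | "i = m" "Suc m < j" | "i < m" "j = Suc m" | "i \<noteq> m" "j \<noteq> Suc m"
    using ij by linarith
  then show "int (b ! j) - int (b ! i) \<le> (int j - int i) * (1 - \<theta>) + 1"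
  proof cases
    case 1
    then show ?thesis using bi bj m by simp
  next
    case 2
    then have "int (a ! j) - int (a ! Suc m) \<le> (int j - int (Suc m)) * (1 - \<theta>) + 1"
      using a[of "Suc m" j] ij m bj by simp
    then show ?thesis using 2 bi bj m by (simp add: algebra_simps)
  next
    case 3
    then have "int (a ! m) - int (a ! i) \<le> (int m - int i) * (1 - \<theta>) + 1"
      using a[of i m] m by simp
    then show ?thesis using 3 bi bj m by (simp add: algebra_simps)
  next
    case 4
    \<comment> \<open>Here \<open>j\<close> gains nothing, so its positivity was there before the
      transition and the old bound applies; the difference has not grown.\<close>
    then have "0 < a ! j" using bj ij(3) by (auto split: if_splits)
    then show ?thesis using a[of i j] 4 ij m bi bj by (auto split: if_splits)
  qed
qed

section \<open>The order, reachable compositions and existence of fixed points\<close>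

lemma top_composition_compositions: "1 \<le> n \<Longrightarrow> top_composition n \<in> compositions n"
  by (simp add: top_composition_def compositions_def sum_list_replicate)

lemma nth_top_composition: "0 < j \<Longrightarrow> j < length (top_composition n) \<Longrightarrow> top_composition n ! j = 0"
  by (simp add: top_composition_def nth_Cons')

lemma top_composition_slope_bounded: "slope_bounded \<theta> (top_composition n)"
  by (simp add: slope_bounded_def nth_top_composition)

lemma energy_top_composition: "energy (top_composition n) = 0"
  unfolding energy_def by (rule sum.neutral) (metis lessThan_iff mult_is_0 neq0_conv nth_top_composition)

lemma geq_refl: "geq \<theta> a a"
  by (simp add: geq_def)

lemma geq_trans: "geq \<theta> a b \<Longrightarrow> geq \<theta> b c \<Longrightarrow> geq \<theta> a c"
  by (simp add: geq_def)

lemma geq_compositions: "geq \<theta> a b \<Longrightarrow> a \<in> compositions n \<Longrightarrow> b \<in> compositions n"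
  unfolding geq_def by (induction rule: rtranclp_induct) (auto intro: transition_compositions)

lemma geq_slope_bounded: "geq \<theta> a b \<Longrightarrow> slope_bounded \<theta> a \<Longrightarrow> slope_bounded \<theta> b"
  unfolding geq_def by (induction rule: rtranclp_induct) (auto intro: transition_slope_bounded)

lemma geq_energy: "geq \<theta> a b \<Longrightarrow> energy a \<le> energy b"
  unfolding geq_def by (induction rule: rtranclp_induct) (auto dest: transition_energy)

text \<open>A first transition on the path would already push the energy above that of
  \<open>b\<close>, so the path is empty.\<close>

lemma geq_energy_eq: "geq \<theta> a b \<Longrightarrow> energy a = energy b \<Longrightarrow> a = b"
  unfolding geq_def
proof (induction rule: converse_rtranclp_induct)
  case (step y z)
  then have "energy z \<le> energy b" using geq_energy unfolding geq_def by blast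
  with step.prems transition_energy[OF step.hyps(1)] show ?case by simp
qed simp

lemma L_geq: "a \<in> L n \<theta> \<Longrightarrow> geq \<theta> a b \<Longrightarrow> b \<in> L n \<theta>"
  unfolding L_def using geq_compositions geq_trans by blast

lemma top_composition_L: "1 \<le> n \<Longrightarrow> top_composition n \<in> L n \<theta>"
  by (simp add: L_def top_composition_compositions geq_refl)

lemma L_slope_bounded: "a \<in> L n \<theta> \<Longrightarrow> slope_bounded \<theta> a"
  unfolding L_def using geq_slope_bounded top_composition_slope_bounded by blast

lemma energy_le: "a \<in> compositions n \<Longrightarrow> energy a \<le> n * n"
proof -
  assume a: "a \<in> compositions n"
  then have "energy a \<le> (\<Sum>i<length a. n * a ! i)"
    unfolding energy_def by (intro sum_mono) (auto simp: compositions_def)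
  also have "\<dots> = n * n"
    using a by (auto simp: compositions_def sum_list_sum_nth atLeast0LessThan sum_distrib_left[symmetric])
  finally show ?thesis .
qed

text \<open>Transitions applied at will must terminate: each raises the energy, which is at most
  \<open>n * n\<close> on compositions.\<close>

lemma fixed_point_below:
  "a \<in> L n \<theta> \<Longrightarrow> \<exists>b. geq \<theta> a b \<and> is_fixed_point n \<theta> b"
proof (induction "n * n - energy a" arbitrary: a rule: less_induct)
  case less
  show ?case
  proof (cases "\<exists>b. transition \<theta> a b")
    case True
    then obtain b where b: "transition \<theta> a b" by blast
    then have ab: "geq \<theta> a b" by (simp add: geq_def)
    then have bL: "b \<in> L n \<theta>" using less.prems L_geq by blast
    \<comment> \<open>Without this bound the truncated difference used as measure might fail to
      drop.\<close>
    then have "energy b \<le> n * n" using energy_le by (simp add: L_def)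
    then have "n * n - energy b < n * n - energy a" using transition_energy[OF b] by simp
    then show ?thesis using less.hyps bL ab geq_trans by blast
  next
    case False
    then show ?thesis using less.prems by (auto simp: is_fixed_point_def intro: geq_refl)
  qed
qed

section \<open>Uniqueness and characterisation of the fixed point\<close>

lemma slope_stable_growth:
  assumes "slope_stable \<theta> a" "i \<le> j" "j < length a" "0 < a ! i"
  shows "(int j - int i) * (1 - \<theta>) \<le> int (a ! j) - int (a ! i)"
  using assms(2,3)
proof (induction j rule: dec_induct)
  case (step j)
  then have IH: "(int j - int i) * (1 - \<theta>) \<le> int (a ! j) - int (a ! i)" by simp
  have "1 - \<theta> \<le> int (a ! Suc j) - int (a ! j)"
  proof (cases "0 < a ! j")
    case True
    then show ?thesis using assms(1) step.prems by (simp add: slope_stable_def)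
  next
    \<comment> \<open>Stability says nothing at a zero entry. But a fall from
      \<open>a ! i > 0\<close> to zero shows that the slope \<open>1 - \<theta>\<close> is negative,
      and the step from zero to \<open>a ! Suc j\<close> cannot go down.\<close>
    case False
    then have "(int j - int i) * (1 - \<theta>) < 0" using IH assms(4) by simp
    then have "1 - \<theta> < 0" using step.hyps by (simp add: mult_less_0_iff)
    then show ?thesis using False by simp
  qed
  then show ?case using IH by (simp add: algebra_simps)
qed simp

text \<open>A crossing needs \<open>a\<close> to gain at least 2 on \<open>b\<close> between
  \<open>i\<close> and \<open>j\<close>, while the two slope bounds allow only 1. The strict
  inequalities make \<open>b ! i\<close> and \<open>a ! j\<close> positive, so the exemptions for
  zeros do not interfere.\<close>

lemma no_crossing:
  assumes "slope_bounded \<theta> a" "slope_stable \<theta> b" "length a = length b"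
    and "i < j" "j < length a" "a ! i < b ! i"
  shows "a ! j \<le> b ! j"
proof (rule ccontr)
  assume neg: "\<not> a ! j \<le> b ! j"
  have "int (a ! j) - int (a ! i) \<le> (int j - int i) * (1 - \<theta>) + 1"
    using assms neg unfolding slope_bounded_def by simp
  moreover have "(int j - int i) * (1 - \<theta>) \<le> int (b ! j) - int (b ! i)"
    using assms by (intro slope_stable_growth) auto
  ultimately show False using neg assms(6) by linarith
qed

lemma slope_bounded_stable_comparable:
  assumes "slope_bounded \<theta> a" "slope_stable \<theta> a" "slope_bounded \<theta> b" "slope_stable \<theta> b"
    and "length a = length b"
  shows "(\<forall>i<length a. a ! i \<le> b ! i) \<or> (\<forall>i<length a. b ! i \<le> a ! i)"
proof (rule ccontr)
  assume "\<not> ?thesis"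
  then obtain i j where "i < length a" "b ! i < a ! i" "j < length a" "a ! j < b ! j"
    by (auto simp: not_le)
  moreover have "i < j \<or> j < i" using calculation by (metis less_asym linorder_neqE_nat)
  ultimately show False
    using no_crossing[of \<theta> a b j i] no_crossing[of \<theta> b a i j] assms by auto
qed

lemma nth_le_sum_list_eq:
  fixes a b :: "nat list"
  assumes "length a = length b" "\<forall>i<length a. a ! i \<le> b ! i" "sum_list a = sum_list b"
  shows "a = b"
proof (rule nth_equalityI[OF assms(1)])
  fix i assume i: "i < length a"
  show "a ! i = b ! i"
  proof (rule ccontr)
    assume "a ! i \<noteq> b ! i"
    with i assms(2) have "a ! i < b ! i" by (simp add: le_neq_implies_less)
    then have "(\<Sum>i<length a. a ! i) < (\<Sum>i<length a. b ! i)"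
      using i assms(2) by (intro sum_strict_mono_ex1) auto
    then show False using assms by (simp add: sum_list_sum_nth atLeast0LessThan)
  qed
qed

lemma slope_bounded_stable_unique:
  assumes "slope_bounded \<theta> a" "slope_stable \<theta> a" "a \<in> compositions n"
    and "slope_bounded \<theta> b" "slope_stable \<theta> b" "b \<in> compositions n"
  shows "a = b"
proof -
  have "length a = length b" "sum_list a = sum_list b"
    using assms by (simp_all add: compositions_def)
  then show ?thesis
    using slope_bounded_stable_comparable[of \<theta> a b] nth_le_sum_list_eq[of a b]
      nth_le_sum_list_eq[of b a] assms by auto
qed

text \<open>For the converse no path from the top composition to \<open>a\<close> is built: some
  fixed point is reachable, and uniqueness identifies it with \<open>a\<close>.\<close>

lemma is_fixed_point_iff:
  assumes "1 \<le> n"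
  shows "is_fixed_point n \<theta> a \<longleftrightarrow> a \<in> compositions n \<and> slope_bounded \<theta> a \<and> slope_stable \<theta> a"
proof
  assume "is_fixed_point n \<theta> a"
  then show "a \<in> compositions n \<and> slope_bounded \<theta> a \<and> slope_stable \<theta> a"
    using L_slope_bounded by (auto simp: is_fixed_point_def slope_stable_iff L_def)
next
  assume a: "a \<in> compositions n \<and> slope_bounded \<theta> a \<and> slope_stable \<theta> a"
  from fixed_point_below[OF top_composition_L[OF assms]]
  obtain b where b: "is_fixed_point n \<theta> b" by blast
  then have "b \<in> compositions n \<and> slope_bounded \<theta> b \<and> slope_stable \<theta> b"
    using L_slope_bounded by (auto simp: is_fixed_point_def slope_stable_iff L_def)
  then have "a = b" using a slope_bounded_stable_unique by blast
  with b show "is_fixed_point n \<theta> a" by simp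
qed

lemma fixed_point_eqI:
  assumes "1 \<le> n" "a \<in> compositions n" "slope_bounded \<theta> a" "slope_stable \<theta> a"
  shows "fixed_point n \<theta> = a"
  unfolding fixed_point_def
proof (rule the_equality)
  show "is_fixed_point n \<theta> a" using assms by (simp add: is_fixed_point_iff)
next
  fix b assume "is_fixed_point n \<theta> b"
  then show "b = a" using assms slope_bounded_stable_unique by (auto simp: is_fixed_point_iff)
qed

lemma L_geq_fixed_point:
  assumes "1 \<le> n" "a \<in> L n \<theta>"
  shows "geq \<theta> a (fixed_point n \<theta>)"
proof -
  obtain b where "geq \<theta> a b" "is_fixed_point n \<theta> b" using fixed_point_below[OF assms(2)] by blast
  moreover from this have "fixed_point n \<theta> = b"
    using is_fixed_point_iff[OF assms(1)] by (intro fixed_point_eqI assms) auto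
  ultimately show ?thesis by simp
qed

lemma fixed_point_L: "1 \<le> n \<Longrightarrow> fixed_point n \<theta> \<in> L n \<theta>"
  using L_geq_fixed_point top_composition_L L_geq by blast

section \<open>Maximal chains have no energy gaps\<close>

context
  fixes n \<theta> C
  assumes n: "1 \<le> n" and C: "maximal_chain n \<theta> C"
begin

lemma maximal_chain_subset: "C \<subseteq> L n \<theta>"
  using C unfolding maximal_chain_def pred_on.maxchain_def pred_on.chain_def by blast

lemma maximal_chain_total:
  assumes "x \<in> C" "y \<in> C"
  shows "geq \<theta> x y \<or> geq \<theta> y x"
  \<comment> \<open>Reflexivity absorbs the reflexive closure in
    \<open>pred_on.chain\<close>.\<close>
  using C assms geq_refl unfolding maximal_chain_def pred_on.maxchain_def pred_on.chain_def by blast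

text \<open>The one place where maximality enters: otherwise \<open>insert z C\<close> would be a
  larger chain.\<close>

lemma maximal_chain_mem:
  assumes "z \<in> L n \<theta>" and "\<And>c. c \<in> C \<Longrightarrow> geq \<theta> c z \<or> geq \<theta> z c"
  shows "z \<in> C"
proof (rule ccontr)
  assume "z \<notin> C"
  moreover have "pred_on.chain (L n \<theta>) (geq \<theta>) (insert z C)"
    using assms maximal_chain_subset maximal_chain_total unfolding pred_on.chain_def by blast
  ultimately show False
    using C unfolding maximal_chain_def pred_on.maxchain_def by blast
qed

text \<open>Inside a chain the energy decides the order: the opposite relation would force equal
  energies and hence equal elements.\<close>

lemma maximal_chain_geqI:
  assumes "x \<in> C" "y \<in> C" "energy x \<le> energy y"
  shows "geq \<theta> x y"
proof (rule ccontr)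
  assume neg: "\<not> geq \<theta> x y"
  with maximal_chain_total assms have yx: "geq \<theta> y x" by blast
  with assms geq_energy have "energy y = energy x" by (meson le_antisym)
  with yx have "y = x" by (rule geq_energy_eq)
  with neg geq_refl show False by simp
qed

lemma inj_on_energy: "inj_on energy C"
  by (rule inj_onI) (metis geq_energy_eq maximal_chain_total)

lemma top_composition_mem: "top_composition n \<in> C"
  using maximal_chain_subset by (intro maximal_chain_mem top_composition_L n) (auto simp: L_def)

lemma fixed_point_mem: "fixed_point n \<theta> \<in> C"
  using maximal_chain_subset L_geq_fixed_point[OF n]
  by (intro maximal_chain_mem fixed_point_L n) blast

text \<open>Let \<open>y\<close> be an element of \<open>C\<close> next above \<open>x\<close> in
  energy. The first composition \<open>z\<close> on a path from \<open>x\<close> to \<open>y\<close>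
  is comparable with all of \<open>C\<close>, so it belongs to \<open>C\<close>.\<close>

lemma energy_step:
  assumes "x \<in> C" "energy x < energy (fixed_point n \<theta>)"
  shows "\<exists>z\<in>C. energy z = Suc (energy x)"
proof -
  define A where "A = {y \<in> C. energy x < energy y}"
  have "fixed_point n \<theta> \<in> A" using assms fixed_point_mem by (simp add: A_def)
  then obtain y where y: "y \<in> A" and min: "\<And>c. c \<in> A \<Longrightarrow> energy y \<le> energy c"
    using ex_has_least_nat[of "\<lambda>y. y \<in> A" _ energy] by blast
  have "geq \<theta> x y" using y assms by (auto simp: A_def intro: maximal_chain_geqI)
  moreover have "x \<noteq> y" using y by (auto simp: A_def)
  ultimately obtain z where z: "transition \<theta> x z" "geq \<theta> z y"
    unfolding geq_def by (cases rule: converse_rtranclpE) auto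
  then have xz: "geq \<theta> x z" by (simp add: geq_def)
  have "z \<in> C"
  proof (rule maximal_chain_mem)
    show "z \<in> L n \<theta>" using xz assms(1) maximal_chain_subset L_geq by blast
  next
    fix c assume c: "c \<in> C"
    show "geq \<theta> c z \<or> geq \<theta> z c"
    proof (cases "energy c \<le> energy x")
      case True
      then show ?thesis using c assms(1) maximal_chain_geqI xz geq_trans by blast
    next
      case False
      then have "energy y \<le> energy c" using c min by (simp add: A_def)
      then have "geq \<theta> y c" using y c by (auto simp: A_def intro: maximal_chain_geqI)
      then show ?thesis using z geq_trans by blast
    qed
  qed
  then show ?thesis using transition_energy[OF z(1)] by blast
qed

text \<open>With injectivity of the energy on \<open>C\<close> this counts the chain: one element
  for each energy from 0 up to that of the fixed point.\<close>

lemma energy_maximal_chain: "energy ` C = {..energy (fixed_point n \<theta>)}"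
proof
  show "energy ` C \<subseteq> {..energy (fixed_point n \<theta>)}"
    using maximal_chain_subset L_geq_fixed_point[OF n] geq_energy by blast
next
  have "e \<in> energy ` C" if "e \<le> energy (fixed_point n \<theta>)" for e
    using that
  proof (induction e)
    case 0
    then show ?case using top_composition_mem energy_top_composition by (metis imageI)
  next
    case (Suc e)
    then obtain x where "x \<in> C" "energy x = e" by auto
    then show ?case using energy_step[of x] Suc.prems by force
  qed
  then show "{..energy (fixed_point n \<theta>)} \<subseteq> energy ` C" by blast
qed

lemma chain_length_maximal_chain: "chain_length C = int (energy (fixed_point n \<theta>))"
  using card_image[OF inj_on_energy] energy_maximal_chain by (simp add: chain_length_def)

end

section \<open>Size of the parameters and closed forms of sums\<close>

text \<open>The only case in which \<open>n\<close> entries cannot hold the progression is \<open>n = k = 1\<close>; then the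
  excluded entry is zero.\<close>

lemma parameters_fit:
  fixes n k l p d :: nat
  assumes "1 \<le> n" "0 < d"
    and "real n = real k * (real k + 1) / 2 * real d + real l * (real k + 1) + real p"
  shows "k < n \<or> n = 1 \<and> k = 1 \<and> d = 1 \<and> l = 0 \<and> p = 0"
proof (cases "k < n")
  case False
  then have kn: "n \<le> k" by simp
  have "real (2 * n) = real (k * (k + 1) * d + 2 * l * (k + 1) + 2 * p)"
    using assms(3) by (simp add: field_simps)
  then have eq: "2 * n = k * (k + 1) * d + 2 * l * (k + 1) + 2 * p"
    by (simp only: of_nat_eq_iff)
  \<comment> \<open>Combined with the doubled equation and \<open>n \<le> k\<close> this gives
    \<open>k * (k + 1) \<le> 2 * k\<close>.\<close>
  have "k * (k + 1) * 1 \<le> k * (k + 1) * d" using assms(2) by (intro mult_le_mono2) simp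
  then have "k * (k + 1) \<le> k * 2" using eq kn by linarith
  then have "k \<le> 1" by (cases "k = 0") simp_all
  then have "k = 1" "n = 1" using kn assms(1) by auto
  then show ?thesis using eq assms(2) by auto
qed simp

lemma sum_of_nat_lessThan: "(\<Sum>j<m. real j) = real m * (real m - 1) / 2"
  by (induction m) (simp_all add: algebra_simps add_divide_distrib diff_divide_distrib)

lemma sum_of_nat_square_lessThan:
  "(\<Sum>j<m. real j * real j) = (real m - 1) * real m * (2 * real m - 1) / 6"
  by (induction m) (simp_all add: algebra_simps add_divide_distrib diff_divide_distrib)

lemma sum_of_bool_less:
  fixes f :: "nat \<Rightarrow> real"
  assumes "p \<le> m"
  shows "(\<Sum>j<m. f j * of_bool (j < p)) = (\<Sum>j<p. f j)"
  using assms by (intro sum.mono_neutral_cong_right) auto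

text \<open>The slope \<open>v\<close> is an arbitrary real, so that \<open>v = d\<close> and
  \<open>v = - d\<close> serve the two staircases, both read from their right end.\<close>

lemma sum_raised_progression:
  assumes "p \<le> m"
  shows "(\<Sum>j<m. u + v * real j + of_bool (j < p)) =
    real m * u + v * (real m * (real m - 1) / 2) + real p"
  using sum_of_bool_less[OF assms, of "\<lambda>_. 1"]
  by (simp add: sum.distrib sum_of_nat_lessThan flip: sum_distrib_left)

text \<open>\<open>A\<close> is the position of the right end of the block: \<open>k\<close> for the
  descending and \<open>n - 1\<close> for the ascending staircase. Thus \<open>A - j\<close> is the
  position \<open>j\<close> places to its left.\<close>

lemma weighted_sum_raised_progression:
  assumes "p \<le> m"
  shows "(\<Sum>j<m. (A - real j) * (u + v * real j + of_bool (j < p))) =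
    real m * A * u + (A * v - u) * (real m * (real m - 1) / 2)
    - v * ((real m - 1) * real m * (2 * real m - 1) / 6) + A * real p - real p * (real p - 1) / 2"
proof -
  have "(\<Sum>j<m. (A - real j) * (u + v * real j + of_bool (j < p))) =
      (\<Sum>j<m. A * u + (A * v - u) * real j - v * (real j * real j)
        + (A - real j) * of_bool (j < p))"
    by (intro sum.cong) (auto simp: algebra_simps)
  also have "\<dots> = real m * (A * u) + (A * v - u) * (\<Sum>j<m. real j)
      - v * (\<Sum>j<m. real j * real j) + (\<Sum>j<m. (A - real j) * of_bool (j < p))"
    by (simp add: sum.distrib sum_subtractf sum_distrib_left)
  also have "(\<Sum>j<m. (A - real j) * of_bool (j < p)) = real p * A - real p * (real p - 1) / 2"
    by (simp add: sum_of_bool_less[OF assms] sum_subtractf sum_of_nat_lessThan)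
  finally show ?thesis
    unfolding sum_of_nat_lessThan sum_of_nat_square_lessThan by (simp add: mult.commute)
qed

section \<open>Staircases\<close>

text \<open>Indexed from the high end, so that one function gives the fixed point for \<theta> \<ge>
  2 read forwards and for \<theta> \<le> 0 read backwards. \<open>P\<close> marks the entries raised
  by one.\<close>

definition staircase :: "nat \<Rightarrow> nat \<Rightarrow> nat \<Rightarrow> (nat \<Rightarrow> bool) \<Rightarrow> nat \<Rightarrow> nat" where
  "staircase d l k P j = (if j \<le> k then (k - j) * d + l + of_bool (P j) else 0)"

lemma int_staircase:
  "j \<le> k \<Longrightarrow> int (staircase d l k P j) = (int k - int j) * int d + int l + of_bool (P j)"
  by (simp add: staircase_def of_nat_diff)

lemma real_staircase:
  "j \<le> k \<Longrightarrow> real (staircase d l k P j) = (real k - real j) * real d + real l + of_bool (P j)"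
  by (simp add: staircase_def of_nat_diff)

lemma real_sum_list_map_upt: "real (sum_list (map f [0..<n])) = (\<Sum>i<n. real (f i))"
  by (simp add: sum_list_sum_nth atLeast0LessThan)

lemma real_energy_map_upt: "real (energy (map f [0..<n])) = (\<Sum>i<n. real i * real (f i))"
  by (simp add: energy_def)

lemma sum_mult_reverse:
  fixes n :: nat
  shows "(\<Sum>i<n. real i * f (n - 1 - i)) = (\<Sum>j<n. (real n - 1 - real j) * f j)"
proof -
  have "(\<Sum>j<n. (real n - 1 - real j) * f j) =
      (\<Sum>i<n. (real n - 1 - real (n - Suc i)) * f (n - Suc i))"
    by (rule sum.nat_diff_reindex[symmetric])
  also have "\<dots> = (\<Sum>i<n. real i * f (n - 1 - i))"
    by (intro sum.cong) (auto simp: of_nat_diff)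
  finally show ?thesis ..
qed

section \<open>The descending fixed point, for \<theta> \<ge> 2\<close>

context
  fixes n k l p d :: nat
  assumes n: "1 \<le> n" and d: "0 < d" and l: "l < d" and p: "p \<le> k + 1"
    and n_eq: "real n = real k * (real k + 1) / 2 * real d + real l * (real k + 1) + real p"
begin

abbreviation descending :: "nat list" where
  "descending \<equiv> map (staircase d l k (\<lambda>j. k < j + p)) [0..<n]"

lemma sum_descending:
  fixes w :: "nat \<Rightarrow> real"
  shows "(\<Sum>j<n. w j * real (staircase d l k (\<lambda>j. k < j + p) j)) =
    (\<Sum>j<Suc k. w (k - j) * (real l + real d * real j + of_bool (j < p)))"
proof -
  define f where "f j = w j * ((real k - real j) * real d + real l + of_bool (k < j + p))" for j
  have "(\<Sum>j<n. w j * real (staircase d l k (\<lambda>j. k < j + p) j)) = (\<Sum>j<n. f j * of_bool (j \<le> k))"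
    by (intro sum.cong) (auto simp: f_def real_staircase staircase_def)
  also have "\<dots> = (\<Sum>j<Suc k. f j)"
    \<comment> \<open>If \<open>k < n\<close>, the indicator cuts the range to \<open>k + 1\<close>
      terms. In the exceptional case the right side has one more term, \<open>f 1\<close>, which
      vanishes.\<close>
    using parameters_fit[OF n d n_eq]
  proof
    assume "k < n"
    then show ?thesis by (intro sum.mono_neutral_cong_right) auto
  next
    assume "n = 1 \<and> k = 1 \<and> d = 1 \<and> l = 0 \<and> p = 0"
    then show ?thesis by (simp add: f_def)
  qed
  also have "\<dots> = (\<Sum>j<Suc k. f (Suc k - Suc j))"
    by (rule sum.nat_diff_reindex[symmetric])
  also have "\<dots> = (\<Sum>j<Suc k. w (k - j) * (real l + real d * real j + of_bool (j < p)))"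
    by (intro sum.cong) (auto simp: f_def of_nat_diff algebra_simps)
  finally show ?thesis .
qed

text \<open>The equation for \<open>n\<close> says exactly that the staircase holds \<open>n\<close>
  units; \<open>p \<le> k + 1\<close> leaves room for all raised entries.\<close>

lemma descending_compositions: "descending \<in> compositions n"
proof -
  have "real (sum_list descending) = (\<Sum>j<Suc k. real l + real d * real j + of_bool (j < p))"
    unfolding real_sum_list_map_upt using sum_descending[of "\<lambda>_. 1"] by simp
  also have "\<dots> = real n"
    using p by (subst sum_raised_progression) (auto simp: n_eq algebra_simps)
  finally show ?thesis by (simp add: compositions_def)
qed

lemma energy_descending:
  "real (energy descending) = real d * ((real k - 1) * real k * (real k + 1) / 6)
    + real l * (real k * (real k + 1) / 2) + real p * ((2 * real k - real p + 1) / 2)"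
proof -
  have "real (energy descending) =
      (\<Sum>j<Suc k. (real k - real j) * (real l + real d * real j + of_bool (j < p)))"
    unfolding real_energy_map_upt sum_descending by (intro sum.cong) (auto simp: of_nat_diff)
  also have "\<dots> = real d * ((real k - 1) * real k * (real k + 1) / 6)
      + real l * (real k * (real k + 1) / 2) + real p * ((2 * real k - real p + 1) / 2)"
    using p by (subst weighted_sum_raised_progression)
      (auto simp: algebra_simps add_divide_distrib diff_divide_distrib)
  finally show ?thesis .
qed

lemma descending_slope_bounded: "slope_bounded (1 + int d) descending"
  unfolding slope_bounded_def
proof (intro allI impI)
  fix i j assume "i < j" "j < length descending" "0 < descending ! j"
  then have "i < j" "j < n" "0 < staircase d l k (\<lambda>j. k < j + p) j" by auto
  moreover from this have "j \<le> k" by (auto simp: staircase_def split: if_splits)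
  ultimately show "int (descending ! j) - int (descending ! i)
      \<le> (int j - int i) * (1 - (1 + int d)) + 1"
    by (simp add: int_staircase algebra_simps)
qed

lemma descending_stable: "slope_stable (1 + int d) descending"
  unfolding slope_stable_def
proof (intro allI impI)
  fix i assume "Suc i < length descending" "0 < descending ! i"
  then have i: "Suc i < n" "0 < staircase d l k (\<lambda>j. k < j + p) i" by auto
  then have "i \<le> k" by (auto simp: staircase_def split: if_splits)
  then consider "Suc i \<le> k" | "i = k" by linarith
  then have "int (staircase d l k (\<lambda>j. k < j + p) i) - int (staircase d l k (\<lambda>j. k < j + p) (Suc i))
      \<le> int d"
  proof cases
    case 1
    then show ?thesis by (simp add: int_staircase algebra_simps)
  next
    \<comment> \<open>At the end of the block the drop to zero is at most \<open>l + 1\<close>,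
      which \<open>l < d\<close> keeps within \<open>d\<close>.\<close>
    case 2
    then show ?thesis using l by (simp add: staircase_def)
  qed
  then show "1 - (1 + int d) \<le> int (descending ! Suc i) - int (descending ! i)"
    using i by simp
qed

section \<open>The ascending fixed point, for \<theta> \<le> 0\<close>

abbreviation ascending :: "nat list" where
  "ascending \<equiv> map (\<lambda>i. staircase d l k (\<lambda>j. j < p) (n - 1 - i)) [0..<n]"

lemma sum_ascending:
  fixes w :: "nat \<Rightarrow> real"
  shows "(\<Sum>j<n. w j * real (staircase d l k (\<lambda>j. j < p) j)) =
    (\<Sum>j<Suc k. w j * (real k * real d + real l + - real d * real j + of_bool (j < p)))"
proof -
  define f where "f j = w j * (real k * real d + real l + - real d * real j + of_bool (j < p))" for j
  have "(\<Sum>j<n. w j * real (staircase d l k (\<lambda>j. j < p) j)) = (\<Sum>j<n. f j * of_bool (j \<le> k))"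
  proof (intro sum.cong refl)
    fix j
    show "w j * real (staircase d l k (\<lambda>j. j < p) j) = f j * of_bool (j \<le> k)"
    proof (cases "j \<le> k")
      case True
      then show ?thesis by (simp add: f_def real_staircase algebra_simps)
    qed (simp add: staircase_def)
  qed
  also have "\<dots> = (\<Sum>j<Suc k. f j)"
    using parameters_fit[OF n d n_eq]
  proof
    assume "k < n"
    then show ?thesis by (intro sum.mono_neutral_cong_right) auto
  next
    assume "n = 1 \<and> k = 1 \<and> d = 1 \<and> l = 0 \<and> p = 0"
    then show ?thesis by (simp add: f_def)
  qed
  finally show ?thesis by (simp only: f_def)
qed

lemma ascending_compositions: "ascending \<in> compositions n"
proof -
  have "real (sum_list ascending) = (\<Sum>i<n. real (staircase d l k (\<lambda>j. j < p) (n - Suc i)))"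
    unfolding real_sum_list_map_upt by simp
  also have "\<dots> = (\<Sum>j<n. real (staircase d l k (\<lambda>j. j < p) j))"
    by (rule sum.nat_diff_reindex)
  also have "\<dots> = (\<Sum>j<Suc k. real k * real d + real l + - real d * real j + of_bool (j < p))"
    using sum_ascending[of "\<lambda>_. 1"] by simp
  also have "\<dots> = real n"
    using p by (subst sum_raised_progression)
      (auto simp: n_eq algebra_simps add_divide_distrib diff_divide_distrib)
  finally show ?thesis by (simp add: compositions_def)
qed

lemma energy_ascending:
  "real (energy ascending) = real d * ((3 * real n - real k - 2) * real k * (real k + 1) / 6)
    + real l * ((real k + 1) * (2 * real n - real k - 2) / 2)
    + real p * ((2 * real n - real p - 1) / 2)"
proof -
  have "real (energy ascending) =
      (\<Sum>j<n. (real n - 1 - real j) * real (staircase d l k (\<lambda>j. j < p) j))"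
    unfolding real_energy_map_upt by (rule sum_mult_reverse)
  also have "\<dots> = (\<Sum>j<Suc k. (real n - 1 - real j) *
      (real k * real d + real l + - real d * real j + of_bool (j < p)))"
    by (rule sum_ascending)
  also have "\<dots> = real d * ((3 * real n - real k - 2) * real k * (real k + 1) / 6)
      + real l * ((real k + 1) * (2 * real n - real k - 2) / 2)
      + real p * ((2 * real n - real p - 1) / 2)"
    using p by (subst weighted_sum_raised_progression)
      (auto simp: algebra_simps add_divide_distrib diff_divide_distrib)
  finally show ?thesis .
qed

lemma ascending_slope_bounded: "slope_bounded (1 - int d) ascending"
  unfolding slope_bounded_def
proof (intro allI impI)
  fix i j assume "i < j" "j < length ascending" "0 < ascending ! j"
  then have ij: "i < j" "j < n" "0 < staircase d l k (\<lambda>j. j < p) (n - 1 - j)" by auto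
  \<comment> \<open>Mirrored positions, in which the staircase is indexed from its high right
    end.\<close>
  define I J where "I = n - 1 - i" and "J = n - 1 - j"
  have IJ: "J < I" "int I - int J = int j - int i" using ij by (auto simp: I_def J_def)
  have "J \<le> k" using ij by (auto simp: J_def staircase_def split: if_splits)
  have "int (staircase d l k (\<lambda>j. j < p) J) - int (staircase d l k (\<lambda>j. j < p) I)
      \<le> (int I - int J) * int d + 1"
  proof (cases "I \<le> k")
    case True
    then show ?thesis using \<open>J \<le> k\<close> by (simp add: int_staircase algebra_simps)
  next
    case False
    \<comment> \<open>Entry \<open>i\<close> is a zero left of the block. The extra step of height
      \<open>d\<close> across the edge of the block covers the remainder
      \<open>l < d\<close>.\<close>
    then have "(int k - int J + 1) * int d \<le> (int I - int J) * int d"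
      by (intro mult_right_mono) auto
    then show ?thesis using False \<open>J \<le> k\<close> l
      by (simp add: int_staircase staircase_def[of d l k _ I] algebra_simps)
  qed
  then show "int (ascending ! j) - int (ascending ! i)
      \<le> (int j - int i) * (1 - (1 - int d)) + 1"
    using ij IJ by (simp add: I_def J_def)
qed

text \<open>The zeros left of the block are exempt. Inside it, the raised entries are the rightmost
  ones, so raising never lowers an increment below \<open>d\<close>.\<close>

lemma ascending_stable: "slope_stable (1 - int d) ascending"
  unfolding slope_stable_def
proof (intro allI impI)
  fix i assume "Suc i < length ascending" "0 < ascending ! i"
  then have i: "Suc i < n" "0 < staircase d l k (\<lambda>j. j < p) (n - 1 - i)" by auto
  define J where "J = n - 1 - Suc i"
  have J: "n - 1 - i = Suc J" using i by (simp add: J_def)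
  then have "Suc J \<le> k" using i by (auto simp: staircase_def split: if_splits)
  then have "int d \<le> int (staircase d l k (\<lambda>j. j < p) J) - int (staircase d l k (\<lambda>j. j < p) (Suc J))"
    by (simp add: int_staircase algebra_simps)
  then show "1 - (1 - int d) \<le> int (ascending ! Suc i) - int (ascending ! i)"
    using i J by (simp add: J_def)
qed

end

section \<open>Chain length and its closed forms\<close>

theorem proposition5:
  fixes n k l p :: nat and \<theta> :: int and C :: "nat list set"
  assumes "n \<ge> 1"
    and "real n = real k * (real k + 1) / 2 * \<bar>1 - real_of_int \<theta>\<bar> + real l * (real k + 1) + real p"
    and "int l < \<bar>1 - \<theta>\<bar>"
    and "p \<le> k + 1"
    and "maximal_chain n \<theta> C"
  shows "chain_length C = int (energy (fixed_point n \<theta>)) \<and>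
         (\<theta> \<ge> 2 \<longrightarrow> real_of_int (chain_length C) =
            (real_of_int \<theta> - 1) * ((real k - 1) * real k * (real k + 1) / 6)
            + real l * (real k * (real k + 1) / 2)
            + real p * ((2 * real k - real p + 1) / 2)) \<and>
         (\<theta> \<le> 1 \<longrightarrow> real_of_int (chain_length C) =
            (1 - real_of_int \<theta>) * ((3 * real n - real k - 2) * real k * (real k + 1) / 6)
            + real l * ((real k + 1) * (2 * real n - real k - 2) / 2)
            + real p * ((2 * real n - real p - 1) / 2))"
proof (intro conjI impI)
  show len: "chain_length C = int (energy (fixed_point n \<theta>))"
    using chain_length_maximal_chain assms(1,5) .
  define d where "d = nat \<bar>1 - \<theta>\<bar>"
  have real_d: "real d = \<bar>1 - real_of_int \<theta>\<bar>" by (simp add: d_def)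
  \<comment> \<open>The strict bound on \<open>l\<close> forces \<open>d > 0\<close>, so
    \<open>\<theta> = 1\<close> cannot occur and the case \<theta> \<le> 1 below is \<theta> \<le>
    0.\<close>
  have d: "0 < d" "l < d" using assms(3) by (auto simp: d_def)
  note params = assms(1) d assms(4) assms(2)[folded real_d]
  show "real_of_int (chain_length C) =
            (real_of_int \<theta> - 1) * ((real k - 1) * real k * (real k + 1) / 6)
            + real l * (real k * (real k + 1) / 2)
            + real p * ((2 * real k - real p + 1) / 2)" if "\<theta> \<ge> 2"
  proof -
    have \<theta>: "\<theta> = 1 + int d" using that by (simp add: d_def)
    show ?thesis
      unfolding len \<theta> fixed_point_eqI[OF assms(1) descending_compositions[OF params]
        descending_slope_bounded[OF params] descending_stable[OF params]]
      using energy_descending[OF params] by simp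
  qed
  show "real_of_int (chain_length C) =
            (1 - real_of_int \<theta>) * ((3 * real n - real k - 2) * real k * (real k + 1) / 6)
            + real l * ((real k + 1) * (2 * real n - real k - 2) / 2)
            + real p * ((2 * real n - real p - 1) / 2)" if "\<theta> \<le> 1"
  proof -
    have \<theta>: "\<theta> = 1 - int d" using that by (simp add: d_def)
    show ?thesis
      unfolding len \<theta> fixed_point_eqI[OF assms(1) ascending_compositions[OF params]
        ascending_slope_bounded[OF params] ascending_stable[OF params]]
      using energy_ascending[OF params] by simp
  qed
qed

end
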